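(* If $\mathcal F$ is a 2-intersecting family in a (finite) Laguerre plane of order $q$, then $|\mathcal F| < \frac{q^2+1}{2}$.
   Context: All incidence structures are finite. An incidence structure $(\mathcal P, \mathcal B)$ consists of a set $\mathcal P$ of points and a set $\mathcal B$ of subsets of $\mathcal P$, here called circles. A parallel relation is a partition of $\mathcal P$ into parallel classes; two points are parallel if they are in the same parallel class. Given an incidence structure with one parallel relation and a point $P \in \mathcal P$, the residue at $P$ is the incidence structure $(\mathcal P_P, \mathcal B_P)$, where $\mathcal P_P$ is the set of points not parallel to $P$ and $\mathcal B_P = \{ B \cap \mathcal P_P : B \in \mathcal B'_P\}$, with $\mathcal B'_P$ the set consisting of all circles through $P$ and all parallel classes not containing $P$. A Laguerre plane is an incidence structure with one parallel relation such that the residue at each point is an affine plane. Characteristic properties: every three pairwise non-parallel points lie on a unique circle; given two non-parallel points $P$ and $Q$ and a circle $c$ through $P$ but not through $Q$, there is a unique circle through $P$ and $Q$ which intersects $c$ only in $P$; every circle meets every parallel class in exactly one point. The residues all have the same order $q$ as affine planes, and this $q$ is called the order of the Laguerre plane; then every circle has $q+1$ points, every point lies on $q^2$ circles, every parallel class has $q$ points, $|\mathcal P| = q(q+1)$ and $|\mathcal B| = q^3$. A 2-intersecting family is a set $\mathcal F \subseteq \mathcal B$ of circles any two of which have at least two points in common. *)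

theory Defs
  imports Complex_Main "HOL-Library.Disjoint_Sets"
begin

locale incidence_structure =
  fixes points :: "'a set" and blocks :: "'a set set"
  assumes finite_points: "finite points"
    and blocks_subset: "\<And>B. B \<in> blocks \<Longrightarrow> B \<subseteq> points"

locale affine_plane = incidence_structure points lines
  for points :: "'a set" and lines :: "'a set set" +
  assumes unique_line:
      "\<And>x y. \<lbrakk>x \<in> points; y \<in> points; x \<noteq> y\<rbrakk> \<Longrightarrow> \<exists>!l. l \<in> lines \<and> x \<in> l \<and> y \<in> l"
    and unique_parallel:
      "\<And>x l. \<lbrakk>x \<in> points; l \<in> lines; x \<notin> l\<rbrakk> \<Longrightarrow> \<exists>!m. m \<in> lines \<and> x \<in> m \<and> l \<inter> m = {}"
    and noncollinear:
      "\<exists>x\<in>points. \<exists>y\<in>points. \<exists>z\<in>points.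
         x \<noteq> y \<and> x \<noteq> z \<and> y \<noteq> z \<and> \<not> (\<exists>l\<in>lines. x \<in> l \<and> y \<in> l \<and> z \<in> l)"

definition affine_plane_of_order :: "'a set \<Rightarrow> 'a set set \<Rightarrow> nat \<Rightarrow> bool" where
  "affine_plane_of_order points lines q \<longleftrightarrow>
     affine_plane points lines \<and> (\<forall>l\<in>lines. card l = q)"

text \<open>A parallel relation is represented by its set of parallel classes.\<close>

definition parallel :: "'a set set \<Rightarrow> 'a \<Rightarrow> 'a \<Rightarrow> bool" where
  "parallel classes x y \<longleftrightarrow> (\<exists>C\<in>classes. x \<in> C \<and> y \<in> C)"

definition residue_points :: "'a set \<Rightarrow> 'a set set \<Rightarrow> 'a \<Rightarrow> 'a set" where
  "residue_points points classes x = {y \<in> points. \<not> parallel classes x y}"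

definition residue_blocks ::
  "'a set \<Rightarrow> 'a set set \<Rightarrow> 'a set set \<Rightarrow> 'a \<Rightarrow> 'a set set" where
  "residue_blocks points circles classes x =
     (\<lambda>B. B \<inter> residue_points points classes x) `
       ({B \<in> circles. x \<in> B} \<union> {C \<in> classes. x \<notin> C})"

text \<open>
  Since the blocks of a residue form a set, the residues do not see an empty circle, nor a
  circle that is the union of two parallel classes: the latter induces the same block as one
  of the classes. The assumption \<open>circle_meets_class\<close>, part of the usual axioms of
  a Laguerre plane, excludes these degenerate circles.
\<close>

locale laguerre_plane = incidence_structure points circles
  for points :: "'a set" and circles :: "'a set set" +
  fixes classes :: "'a set set"
  assumes parallel_partition: "partition_on points classes"
    and residue_affine:
      "\<And>x. x \<in> points \<Longrightarrow>
         affine_plane (residue_points points classes x) (residue_blocks points circles classes x)"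
    and circle_meets_class:
      "\<And>B C. \<lbrakk>B \<in> circles; C \<in> classes\<rbrakk> \<Longrightarrow> \<exists>!x. x \<in> B \<and> x \<in> C"

text \<open>Nonemptiness ensures that there is a residue, so that the order is determined.\<close>

definition laguerre_plane_of_order ::
  "'a set \<Rightarrow> 'a set set \<Rightarrow> 'a set set \<Rightarrow> nat \<Rightarrow> bool" where
  "laguerre_plane_of_order points circles classes q \<longleftrightarrow>
     laguerre_plane points circles classes \<and> points \<noteq> {} \<and>
     (\<forall>x\<in>points. affine_plane_of_order
        (residue_points points classes x) (residue_blocks points circles classes x) q)"

definition two_intersecting_family :: "'a set set \<Rightarrow> 'a set set \<Rightarrow> bool" where
  "two_intersecting_family circles F \<longleftrightarrow>
     F \<subseteq> circles \<and> (\<forall>B\<in>F. \<forall>C\<in>F. B \<noteq> C \<longrightarrow> card (B \<inter> C) \<ge> 2)"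

end

theory Submission
  imports Defs
begin

text \<open>
  Call the number of members of the family through a point its degree. The members through a
  point \<open>P\<close> induce, in the affine plane residual at \<open>P\<close>, lines that pairwise meet,
  so they lie in distinct directions; the \<open>q + 1\<close> directions include the one of the
  parallel classes, which no circle has. Hence every degree is at most \<open>q\<close>
  (\<open>degree_le_card_class\<close>).

  Fix a member \<open>B\<close>. It has \<open>q + 1\<close> points, and each of the other
  \<open>n - 1\<close> members meets it at least twice, so counting incidences along \<open>B\<close> gives
  \<open>(q + 1) + 2 (n - 1) \<le> (q + 1) q\<close>, that is, \<open>2 n \<le> q\<^sup>2 + 1\<close>
  (\<open>incidences_along_member\<close>). If equality held, then all points on members would have degree
  exactly \<open>q\<close>. But every circle meets a given parallel class exactly once, so the degrees
  along a class add up to \<open>n\<close>, and \<open>n\<close> would be a multiple of \<open>q\<close>. Then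
  \<open>q\<close> would divide \<open>q\<^sup>2 + 1\<close>, which is impossible for \<open>q \<ge> 2\<close>.
\<close>

section \<open>Circles, classes and tangency\<close>

context laguerre_plane
begin

lemma finite_circles: "finite circles"
  using finite_points blocks_subset by (meson Pow_iff finite_Pow_iff finite_subset subsetI)

lemma class_exists: "x \<in> points \<Longrightarrow> \<exists>C\<in>classes. x \<in> C"
  using partition_onD1[OF parallel_partition] by blast

lemma class_subset: "C \<in> classes \<Longrightarrow> C \<subseteq> points"
  using partition_onD1[OF parallel_partition] by blast

lemma class_eqI: "\<lbrakk>C \<in> classes; D \<in> classes; x \<in> C; x \<in> D\<rbrakk> \<Longrightarrow> C = D"
  using partition_onD2[OF parallel_partition] by (auto dest: disjointD)

lemma circle_parallel_eq:
  "\<lbrakk>B \<in> circles; x \<in> B; y \<in> B; parallel classes x y\<rbrakk> \<Longrightarrow> x = y"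
  unfolding parallel_def using circle_meets_class by blast

lemma circle_residue:
  assumes "B \<in> circles" "x \<in> B"
  shows "B \<inter> residue_points points classes x = B - {x}"
proof -
  have "x \<in> points"
    using assms blocks_subset by blast
  then have "parallel classes x x"
    using class_exists unfolding parallel_def by blast
  then show ?thesis
    using assms blocks_subset circle_parallel_eq unfolding residue_points_def by blast
qed

lemma class_residue:
  assumes "C \<in> classes" "x \<notin> C"
  shows "C \<inter> residue_points points classes x = C"
  using assms class_subset class_eqI unfolding residue_points_def parallel_def by blast

lemma circle_in_residue:
  "\<lbrakk>B \<in> circles; x \<in> B\<rbrakk> \<Longrightarrow> B - {x} \<in> residue_blocks points circles classes x"
  unfolding residue_blocks_def using circle_residue
  by (metis (no_types, lifting) UnI1 image_eqI mem_Collect_eq)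

lemma class_in_residue:
  "\<lbrakk>C \<in> classes; x \<notin> C\<rbrakk> \<Longrightarrow> C \<in> residue_blocks points circles classes x"
  unfolding residue_blocks_def using class_residue
  by (metis (no_types, lifting) UnI2 image_eqI mem_Collect_eq)

lemma residue_blocks_cases:
  assumes "l \<in> residue_blocks points circles classes x"
  obtains B where "B \<in> circles" "x \<in> B" "l = B - {x}"
  | C where "C \<in> classes" "x \<notin> C" "l = C"
  using assms circle_residue class_residue unfolding residue_blocks_def by blast

lemma circle_eqI:
  assumes "B \<in> circles" "D \<in> circles" "{x, y, z} \<subseteq> B" "{x, y, z} \<subseteq> D"
    and "x \<noteq> y" "x \<noteq> z" "y \<noteq> z"
  shows "B = D"
proof -
  have x: "x \<in> points"
    using assms blocks_subset by blast
  have "y \<in> residue_points points classes x" "z \<in> residue_points points classes x"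
    using assms circle_residue[of B x] by blast+
  then have "B - {x} = D - {x}"
    using affine_plane.unique_line[OF residue_affine[OF x], of y z]
      circle_in_residue[of B x] circle_in_residue[of D x] assms by auto
  then show ?thesis
    using assms by blast
qed

text \<open>
  Tangency at \<open>x\<close> is parallelism in the residue at \<open>x\<close>. The parallel to a circle
  cannot come from a parallel class, because circles meet all classes.
\<close>

lemma tangent_circle_exists:
  assumes "B \<in> circles" "x \<in> B" "y \<in> residue_points points classes x" "y \<notin> B"
  shows "\<exists>M\<in>circles. x \<in> M \<and> y \<in> M \<and> B \<inter> M = {x}"
proof -
  have x: "x \<in> points"
    using assms blocks_subset by blast
  obtain l where l: "l \<in> residue_blocks points circles classes x" "y \<in> l" "(B - {x}) \<inter> l = {}"
    using affine_plane.unique_parallel[OF residue_affine[OF x] assms(3) circle_in_residue]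
      assms by blast
  from l(1) show ?thesis
  proof (cases rule: residue_blocks_cases)
    case (1 M)
    then show ?thesis
      using l assms by blast
  next
    case (2 C)
    then show ?thesis
      using l circle_meets_class[OF assms(1), of C] by blast
  qed
qed

lemma tangent_circle_unique:
  assumes "B \<in> circles" "x \<in> B" "y \<notin> B"
    and "M \<in> circles" "y \<in> M" "B \<inter> M = {x}"
    and "N \<in> circles" "y \<in> N" "B \<inter> N = {x}"
  shows "M = N"
proof -
  have x: "x \<in> points"
    using assms blocks_subset by blast
  have y: "y \<in> residue_points points classes x"
    using assms circle_residue[of M x] by blast
  have "M - {x} = N - {x}"
    using affine_plane.unique_parallel[OF residue_affine[OF x] y circle_in_residue[OF assms(1,2)]]
      circle_in_residue[of M x] circle_in_residue[of N x] assms by blast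
  then show ?thesis
    using assms by blast
qed

section \<open>Degree of a point\<close>

text \<open>
  The count of directions in the residue at \<open>x\<close>. Each circle of \<open>G\<close> is moved, within
  its direction, to the circle through a fixed second point \<open>z\<close>; circles in distinct
  directions have distinct images. A circle through \<open>x\<close> and \<open>z\<close> is in turn
  determined by its point on a class containing neither of them.
\<close>

lemma degree_le_card_class:
  assumes G: "G \<subseteq> circles" "\<And>B. B \<in> G \<Longrightarrow> x \<in> B"
    and meet: "\<And>B D. \<lbrakk>B \<in> G; D \<in> G; B \<noteq> D\<rbrakk> \<Longrightarrow> \<exists>w. w \<noteq> x \<and> w \<in> B \<and> w \<in> D"
    and z: "z \<in> residue_points points classes x"
    and C: "C \<in> classes" "x \<notin> C" "z \<notin> C"
  shows "card G \<le> card C"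
proof -
  have "\<exists>M. M \<in> circles \<and> x \<in> M \<and> z \<in> M \<and> (B = M \<or> B \<inter> M = {x})" if "B \<in> G" for B
    using tangent_circle_exists[of B x z] that G z by blast
  then obtain t where t: "\<And>B. B \<in> G \<Longrightarrow>
      t B \<in> circles \<and> x \<in> t B \<and> z \<in> t B \<and> (B = t B \<or> B \<inter> t B = {x})"
    by metis
  have t_inj: "inj_on t G"
  proof (rule inj_onI, rule ccontr)
    fix B D
    assume BD: "B \<in> G" "D \<in> G" "t B = t D" "B \<noteq> D"
    then obtain w where w: "w \<noteq> x" "w \<in> B" "w \<in> D"
      using meet by blast
    show False
    proof (cases "w \<in> t B")
      case True
      \<comment> \<open>A circle tangent to \<open>t B\<close> at \<open>x\<close> does not meet it in \<open>w\<close>, so both circles equal \<open>t B\<close>.\<close>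
      then show False
        using w BD t[of B] t[of D] by auto
    next
      case False
      \<comment> \<open>Both circles are tangents to \<open>t B\<close> at \<open>x\<close> through \<open>w\<close>.\<close>
      then show False
        using w BD t[of B] t[of D] G tangent_circle_unique[of "t B" x w B D]
        by (metis Int_commute subsetD)
    qed
  qed
  have "\<exists>p. p \<in> t B \<and> p \<in> C" if "B \<in> G" for B
    using circle_meets_class[of "t B" C] t[OF that] C by blast
  then obtain p where p: "\<And>B. B \<in> G \<Longrightarrow> p B \<in> t B \<and> p B \<in> C"
    by metis
  have xz: "x \<noteq> z"
    using z class_exists unfolding residue_points_def parallel_def by blast
  have "inj_on p G"
  proof (rule inj_onI)
    fix B D
    assume BD: "B \<in> G" "D \<in> G" "p B = p D"
    then have "t B = t D"
      using circle_eqI[of "t B" "t D" x z "p B"] t[of B] t[of D] p[of B] p[of D] C xz by auto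
    then show "B = D"
      using t_inj BD by (meson inj_onD)
  qed
  moreover have "p ` G \<subseteq> C"
    using p by blast
  moreover have "finite C"
    using C class_subset finite_points finite_subset by blast
  ultimately show ?thesis
    using card_inj_on_le by blast
qed

text \<open>
  If only one class avoided \<open>x\<close>, the residue at \<open>x\<close> would be a single line.
\<close>

lemma class_avoiding_point:
  assumes "x \<in> points"
  obtains z C where "z \<in> residue_points points classes x" "C \<in> classes" "x \<notin> C" "z \<notin> C"
proof -
  let ?R = "residue_points points classes x"
  interpret R: affine_plane ?R "residue_blocks points circles classes x"
    using residue_affine assms .
  obtain u where u: "u \<in> ?R"
    using R.noncollinear by blast
  obtain K where K: "K \<in> classes" "u \<in> K" "x \<notin> K"
    using u class_exists unfolding residue_points_def parallel_def by blast
  have "\<not> ?R \<subseteq> K"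
    using R.noncollinear class_in_residue[OF K(1,3)] by blast
  then obtain v where v: "v \<in> ?R" "v \<notin> K"
    by blast
  show ?thesis
    using that[OF v(1) K(1,3) v(2)] .
qed

end

section \<open>Incidence counts\<close>

lemma card_circle:
  assumes "laguerre_plane_of_order points circles classes q" "B \<in> circles"
  shows "card B = q + 1"
proof -
  interpret laguerre_plane points circles classes
    using assms unfolding laguerre_plane_of_order_def by blast
  obtain x where x: "x \<in> B"
    using assms class_exists circle_meets_class unfolding laguerre_plane_of_order_def by blast
  have "x \<in> points"
    using x assms blocks_subset by blast
  then have "card (B - {x}) = q"
    using assms circle_in_residue[OF assms(2) x]
    unfolding laguerre_plane_of_order_def affine_plane_of_order_def by blast
  moreover have "finite B"
    using assms blocks_subset finite_points finite_subset by blast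
  ultimately show ?thesis
    using x by (metis Suc_eq_plus1 card.remove)
qed

lemma order_ge_2:
  assumes "laguerre_plane_of_order points circles classes q"
  shows "2 \<le> q"
proof -
  obtain x where x: "x \<in> points"
    using assms unfolding laguerre_plane_of_order_def by blast
  let ?R = "residue_points points classes x" and ?L = "residue_blocks points circles classes x"
  have R: "affine_plane ?R ?L" "\<And>l. l \<in> ?L \<Longrightarrow> card l = q"
    using assms x unfolding laguerre_plane_of_order_def affine_plane_of_order_def by blast+
  interpret R: affine_plane ?R ?L
    using R(1) .
  obtain u v where uv: "u \<in> ?R" "v \<in> ?R" "u \<noteq> v"
    using R.noncollinear by blast
  then obtain l where l: "l \<in> ?L" "u \<in> l" "v \<in> l"
    using R.unique_line by blast
  then have "finite l"
    using R.blocks_subset R.finite_points finite_subset by blast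
  then have "card {u, v} \<le> card l"
    using l by (intro card_mono) auto
  then show ?thesis
    using R(2)[OF l(1)] uv by simp
qed

lemma degree_le_order:
  assumes L: "laguerre_plane_of_order points circles classes q"
    and F: "two_intersecting_family circles F" and x: "x \<in> points"
  shows "card {D \<in> F. x \<in> D} \<le> q"
proof -
  interpret laguerre_plane points circles classes
    using L unfolding laguerre_plane_of_order_def by blast
  obtain z C where z: "z \<in> residue_points points classes x"
    and C: "C \<in> classes" "x \<notin> C" "z \<notin> C"
    using class_avoiding_point[OF x] by blast
  have "card C = q"
    using L x class_in_residue[OF C(1,2)]
    unfolding laguerre_plane_of_order_def affine_plane_of_order_def by blast
  moreover have "card {D \<in> F. x \<in> D} \<le> card C"
  proof (rule degree_le_card_class[OF _ _ _ z C])
    fix B D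
    assume BD: "B \<in> {D \<in> F. x \<in> D}" "D \<in> {D \<in> F. x \<in> D}" "B \<noteq> D"
    then have "2 \<le> card (B \<inter> D)"
      using F unfolding two_intersecting_family_def by blast
    moreover have "card (B \<inter> D) \<le> 1" if "B \<inter> D \<subseteq> {x}"
      using card_mono[OF _ that] by simp
    ultimately have "\<not> B \<inter> D \<subseteq> {x}"
      by linarith
    then show "\<exists>w. w \<noteq> x \<and> w \<in> B \<and> w \<in> D"
      by blast
  qed (use F in \<open>auto simp: two_intersecting_family_def\<close>)
  ultimately show ?thesis
    by simp
qed

lemma sum_degrees:
  assumes "finite A" "finite F"
  shows "(\<Sum>x\<in>A. card {D \<in> F. x \<in> D}) = (\<Sum>D\<in>F. card (A \<inter> D))"
  using sum.swap_restrict[OF assms, of "\<lambda>_ _. 1 :: nat" "\<lambda>x D. x \<in> D"]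
  by (simp add: Int_def)

text \<open>
  Counted by circles: \<open>B\<close> shares \<open>q + 1\<close> points with itself and at least two
  with every other member.
\<close>

lemma incidences_along_member:
  assumes L: "laguerre_plane_of_order points circles classes q"
    and F: "two_intersecting_family circles F" and B: "B \<in> F"
  shows "q + 1 + 2 * (card F - 1) \<le> (\<Sum>x\<in>B. card {D \<in> F. x \<in> D})"
proof -
  interpret laguerre_plane points circles classes
    using L unfolding laguerre_plane_of_order_def by blast
  have F': "F \<subseteq> circles" "\<And>D. D \<in> F - {B} \<Longrightarrow> 2 \<le> card (B \<inter> D)"
    using F B unfolding two_intersecting_family_def by blast+
  have fin: "finite F" "finite B"
    using finite_subset[OF F'(1) finite_circles]
      finite_subset[OF blocks_subset finite_points, of B] F'(1) B by blast+
  have cB: "card B = q + 1"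
    using card_circle[OF L, of B] F'(1) B by blast
  have "2 * (card F - 1) = (\<Sum>D\<in>F - {B}. 2)"
    using B by simp
  also have "\<dots> \<le> (\<Sum>D\<in>F - {B}. card (B \<inter> D))"
    by (rule sum_mono) (rule F'(2))
  finally have "q + 1 + 2 * (card F - 1) \<le> card (B \<inter> B) + (\<Sum>D\<in>F - {B}. card (B \<inter> D))"
    using cB by simp
  also have "\<dots> = (\<Sum>D\<in>F. card (B \<inter> D))"
    using sum.remove[OF fin(1) B, of "\<lambda>D. card (B \<inter> D)"] by simp
  finally show ?thesis
    using sum_degrees[OF fin(2,1)] by simp
qed

section \<open>The bound\<close>

theorem theorem5p10:
  fixes points :: "'a set" and circles classes F :: "'a set set" and q :: nat
  assumes "laguerre_plane_of_order points circles classes q"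
    and "two_intersecting_family circles F"
  shows "real (card F) < ((real q)\<^sup>2 + 1) / 2"
proof (cases "F = {}")
  case True
  then show ?thesis
    by (simp add: add_nonneg_pos)
next
  case False
  interpret laguerre_plane points circles classes
    using assms unfolding laguerre_plane_of_order_def by blast
  let ?deg = "\<lambda>x. card {D \<in> F. x \<in> D}"
  have F: "F \<subseteq> circles"
    using assms unfolding two_intersecting_family_def by blast
  have finF: "finite F"
    using F finite_circles finite_subset by blast
  then have pos: "0 < card F"
    using False by (simp add: card_gt_0_iff)
  have sum_upper: "(\<Sum>x\<in>B. ?deg x) \<le> (q + 1) * q" if "B \<in> F" for B
    using sum_bounded_above[of B ?deg q] degree_le_order[OF assms] blocks_subset
      card_circle[OF assms(1), of B] F that by fastforce
  obtain B where B: "B \<in> F"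
    using False by blast
  have "q + 1 + 2 * (card F - 1) \<le> (q + 1) * q"
    using incidences_along_member[OF assms B] sum_upper[OF B] by linarith
  then have le: "2 * card F \<le> q\<^sup>2 + 1"
    using pos by (simp add: power2_eq_square algebra_simps)
  have "2 * card F \<noteq> q\<^sup>2 + 1"
  proof
    assume eq: "2 * card F = q\<^sup>2 + 1"
    \<comment> \<open>A smaller degree on a member would leave slack in the count along that member.\<close>
    have deg: "?deg x = q" if "D \<in> F" "x \<in> D" for D x
    proof (rule ccontr)
      assume "?deg x \<noteq> q"
      have finD: "finite D"
        using that F blocks_subset finite_points finite_subset by blast
      have D_points: "D \<subseteq> points"
        using that F blocks_subset by blast
      have "?deg x < q"
        using degree_le_order[OF assms, of x] D_points that \<open>?deg x \<noteq> q\<close> by fastforce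
      then have "(\<Sum>y\<in>D. ?deg y) < (\<Sum>y\<in>D. q)"
        using degree_le_order[OF assms] D_points that finD
        by (intro sum_strict_mono_ex1) auto
      also have "\<dots> = (q + 1) * q"
        using card_circle[OF assms(1), of D] F that by auto
      finally show False
        using incidences_along_member[OF assms that(1)] eq pos
        by (simp add: power2_eq_square algebra_simps)
    qed
    obtain C where C: "C \<in> classes"
      using assms(1) class_exists unfolding laguerre_plane_of_order_def by blast
    have finC: "finite C"
      using C class_subset finite_points finite_subset by blast
    have "card (C \<inter> D) = 1" if D: "D \<in> F" for D
    proof -
      obtain y where "y \<in> D \<and> y \<in> C" "\<And>w. w \<in> D \<and> w \<in> C \<Longrightarrow> w = y"
        using circle_meets_class[of D C] D F C by blast
      then have "C \<inter> D = {y}"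
        by blast
      then show ?thesis
        by simp
    qed
    then have "card F = (\<Sum>x\<in>C. ?deg x)"
      using sum_degrees[OF finC finF] by simp
    moreover have "q dvd (\<Sum>x\<in>C. ?deg x)"
    proof (rule dvd_sum)
      fix x
      show "q dvd ?deg x"
      proof (cases "\<exists>D\<in>F. x \<in> D")
        case True
        then show ?thesis
          using deg by auto
      next
        case False
        then have "{D \<in> F. x \<in> D} = {}"
          by blast
        then show ?thesis
          by (metis card.empty dvd_0_right)
      qed
    qed
    ultimately have "q dvd q\<^sup>2 + 1"
      using eq by (metis dvd_mult)
    moreover have "q dvd q\<^sup>2"
      by simp
    ultimately have "q dvd 1"
      using dvd_add_right_iff by blast
    then show False
      using order_ge_2[OF assms(1)] by simp
  qed
  with le have "2 * card F < q\<^sup>2 + 1"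
    by simp
  then have "real (2 * card F) < real (q\<^sup>2 + 1)"
    by (simp only: of_nat_less_iff)
  then show ?thesis
    by simp
qed

end
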